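(* Let $\mathcal{H}$ be a real finite-dimensional Hilbert space with inner product $(\cdot,\cdot)$ and let $A$ be a self-adjoint positive definite linear operator on $\mathcal{H}$. For any linear operator $E:\mathcal{H}\to\mathcal{H}$, it holds that $$\rho(EE) \le \|EE\|_A \le \|E\|_A^2 = \|EE^*\|_A = \rho(EE^* ).$$
   Context: $(u,v)_A=(Au,v)$, $\|u\|_A=(u,u)_A^{1/2}$, and $\|M\|_A$ is the operator norm induced by $\|\cdot\|_A$. $E^*$ denotes the $A$-adjoint of $E$, i.e. the unique operator with $(Eu,v)_A=(u,E^*v)_A$ for all $u,v\in\mathcal{H}$. $\rho(M)$ is the spectral radius of $M$ (the maximum modulus of its, possibly complex, eigenvalues). *)

theory Defs
  imports "HOL-Analysis.Analysis"
begin

definition inner_wrt :: "('a::real_inner \<Rightarrow> 'a) \<Rightarrow> 'a \<Rightarrow> 'a \<Rightarrow> real" where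
  "inner_wrt A u v = A u \<bullet> v"

definition norm_wrt :: "('a::real_inner \<Rightarrow> 'a) \<Rightarrow> 'a \<Rightarrow> real" where
  "norm_wrt A u = sqrt (inner_wrt A u u)"

definition onorm_wrt :: "('a::real_inner \<Rightarrow> 'a) \<Rightarrow> ('a \<Rightarrow> 'a) \<Rightarrow> real" where
  "onorm_wrt A M = (SUP u \<in> - {0}. norm_wrt A (M u) / norm_wrt A u)"

definition adjoint_wrt :: "('a::real_inner \<Rightarrow> 'a) \<Rightarrow> ('a \<Rightarrow> 'a) \<Rightarrow> 'a \<Rightarrow> 'a" where
  "adjoint_wrt A E =
    (THE F. linear F \<and> (\<forall>u v. inner_wrt A (E u) v = inner_wrt A u (F v)))"

text \<open>The complexification of a real vector space: the pair \<open>(x, y)\<close> stands for \<open>x + i y\<close>.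
  The complex-linear extension of a real operator \<open>M\<close> is then \<open>map_prod M M\<close>, and
  \<open>cscale\<close> is multiplication by a complex scalar.\<close>

definition cscale :: "complex \<Rightarrow> 'a::real_vector \<times> 'a \<Rightarrow> 'a \<times> 'a" where
  "cscale c z = (Re c *\<^sub>R fst z - Im c *\<^sub>R snd z, Re c *\<^sub>R snd z + Im c *\<^sub>R fst z)"

definition complex_eigenvalue :: "('a::real_vector \<Rightarrow> 'a) \<Rightarrow> complex \<Rightarrow> bool" where
  "complex_eigenvalue M c \<longleftrightarrow> (\<exists>z. z \<noteq> 0 \<and> map_prod M M z = cscale c z)"

definition spectral_radius :: "('a::real_vector \<Rightarrow> 'a) \<Rightarrow> real" where
  "spectral_radius M = Max {cmod c | c. complex_eigenvalue M c}"

end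

theory Submission
  imports Defs "HOL-Computational_Algebra.Fundamental_Theorem_Algebra"
begin

text \<open>
  Write \<open>F\<close> for the \<open>A\<close>-adjoint of \<open>E\<close>, and work throughout in the inner product
  \<open>(u, v)\<^sub>A\<close>.

  The spectral radius of any linear \<open>M\<close> is at most its operator norm: if \<open>x + i y\<close> is an eigenvector
  for \<open>c\<close>, then \<open>M x\<close> and \<open>M y\<close> arise from \<open>x\<close> and \<open>y\<close> by a rotation and a stretching by the
  factor \<open>cmod c\<close>, so \<open>M\<close> multiplies the sum of the two squared norms by \<open>(cmod c)\<^sup>2\<close>
  (\<open>spectral_radius_le_onorm_wrt\<close>). The operator norm is submultiplicative, and Cauchy-Schwarz
  gives \<open>E\<close> and \<open>F\<close> the same norm \<open>K\<close> (\<open>onorm_wrt_adjoint_wrt\<close>). Hence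
  \<open>\<rho>(E E) \<le> \<parallel>E E\<parallel> \<le> K\<^sup>2\<close> and \<open>\<rho>(E F) \<le> \<parallel>E F\<parallel> \<le> K\<^sup>2\<close>.

  Both equalities then follow from \<open>K\<^sup>2 \<le> \<rho>(E F)\<close> alone. The dimension is finite, so some
  \<open>u \<noteq> 0\<close> attains \<open>\<parallel>F u\<parallel> = K \<parallel>u\<parallel>\<close>. Expanding the square gives
  \<open>\<parallel>E F u - K\<^sup>2 u\<parallel>\<^sup>2 = \<parallel>E F u\<parallel>\<^sup>2 - 2 K\<^sup>2 \<parallel>F u\<parallel>\<^sup>2 + K\<^sup>4 \<parallel>u\<parallel>\<^sup>2 \<le> 0\<close>, so that
  \<open>u\<close> is an eigenvector of \<open>E F\<close> for \<open>K\<^sup>2\<close> (\<open>onorm_wrt_power2_le_spectral_radius\<close>).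

  The spectral radius is a maximum, which has its intended meaning only for a finite nonempty set
  of eigenvalues. Both properties come from letting complex polynomials in \<open>M\<close> act on the
  complexified space: linear dependence of the iterates of a vector gives an annihilating
  polynomial; a root of one of least degree is an eigenvalue (\<open>exists_complex_eigenvalue\<close>),
  and all eigenvalues are roots of one that annihilates a basis
  (\<open>finite_complex_eigenvalues\<close>).
\<close>

section \<open>Polynomials of a complexified operator\<close>

lemma cscale_simps [simp]:
  "cscale 0 z = 0" "cscale 1 z = z" "cscale c 0 = 0"
  by (simp_all add: cscale_def prod_eq_iff)

lemma cscale_add_left: "cscale (a + b) z = cscale a z + cscale b z"
  by (simp add: cscale_def prod_eq_iff algebra_simps)

lemma cscale_add_right: "cscale c (z + w) = cscale c z + cscale c w"
  by (simp add: cscale_def prod_eq_iff algebra_simps)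

lemma cscale_cscale: "cscale a (cscale b z) = cscale (a * b) z"
  by (simp add: cscale_def prod_eq_iff algebra_simps)

lemma cscale_scaleR: "cscale c (r *\<^sub>R z) = r *\<^sub>R cscale c z"
  by (simp add: cscale_def prod_eq_iff algebra_simps)

lemma cscale_of_real: "cscale (of_real r) z = r *\<^sub>R z"
  by (simp add: cscale_def prod_eq_iff)

lemma cscale_eq_0_iff: "cscale c z = 0 \<longleftrightarrow> c = 0 \<or> z = 0"
proof (cases "c = 0")
  case False
  then have "z = cscale (inverse c) (cscale c z)"
    by (simp add: cscale_cscale)
  then show ?thesis
    using False by (metis cscale_simps(3))
qed simp

lemma linear_map_prod:
  assumes "linear M"
  shows "linear (map_prod M M)"
  using assms by (intro linearI) (auto simp: linear_add linear_scale map_prod_def split: prod.splits)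

lemma map_prod_cscale:
  assumes "linear M"
  shows "map_prod M M (cscale c z) = cscale c (map_prod M M z)"
  using assms by (simp add: cscale_def prod_eq_iff linear_add linear_diff linear_scale)

text \<open>The action of \<open>p(M)\<close> on the complexification, evaluated by Horner's scheme.\<close>

definition poly_op :: "('a::real_vector \<Rightarrow> 'a) \<Rightarrow> complex poly \<Rightarrow> 'a \<times> 'a \<Rightarrow> 'a \<times> 'a" where
  "poly_op M p z = fold_coeffs (\<lambda>c w. cscale c z + map_prod M M w) p 0"

context
  fixes M :: "'a::real_vector \<Rightarrow> 'a"
  assumes lin: "linear M"
begin

lemma map_prod_0 [simp]: "map_prod M M 0 = 0"
  using linear_map_prod[OF lin] by (rule linear_0)

lemma poly_op_0 [simp]: "poly_op M 0 z = 0"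
  by (simp add: poly_op_def)

lemma poly_op_pCons [simp]:
  "poly_op M (pCons c p) z = cscale c z + map_prod M M (poly_op M p z)"
  by (cases "c = 0 \<and> p = 0") (auto simp: poly_op_def)

lemma poly_op_add: "poly_op M (p + q) z = poly_op M p z + poly_op M q z"
  by (induction p q rule: poly_induct2)
     (simp_all add: cscale_add_left linear_add[OF linear_map_prod[OF lin]])

lemma poly_op_smult: "poly_op M (smult c p) z = cscale c (poly_op M p z)"
  by (induction p) (simp_all add: cscale_add_right cscale_cscale map_prod_cscale[OF lin])

text \<open>
  Composition of operators is multiplication of polynomials; in particular, all polynomials in
  \<open>M\<close> commute with each other.
\<close>

lemma poly_op_mult: "poly_op M (p * q) z = poly_op M p (poly_op M q z)"
  by (induction p) (simp_all add: poly_op_add poly_op_smult)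

lemma poly_op_sum: "poly_op M (\<Sum>i\<in>I. p i) z = (\<Sum>i\<in>I. poly_op M (p i) z)"
  by (induction I rule: infinite_finite_induct) (simp_all add: poly_op_add)

lemma poly_op_monom: "poly_op M (monom c i) z = cscale c ((map_prod M M ^^ i) z)"
  by (induction i) (simp_all add: monom_0 monom_Suc map_prod_cscale[OF lin])

lemma linear_poly_op: "linear (poly_op M p)"
proof (induction p)
  case 0
  show ?case by (auto intro!: linearI)
next
  case (pCons c p)
  then show ?case
    using linear_map_prod[OF lin]
    by (intro linearI)
       (simp_all add: linear_add linear_scale cscale_add_right cscale_scaleR scaleR_add_right)
qed

lemma poly_op_eigenvector:
  assumes "map_prod M M z = cscale c z"
  shows "poly_op M p z = cscale (poly p c) z"
  by (induction p)
     (simp_all add: map_prod_cscale[OF lin] assms cscale_cscale cscale_add_left mult.commute)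

end

section \<open>Existence and finiteness of complex eigenvalues\<close>

text \<open>
  There are \<open>n + 1\<close> iterates of \<open>z\<close> of order \<open>0, \<dots>, n\<close>, more than the real dimension \<open>n\<close> of the
  complexification. So either two of them coincide or they are linearly dependent, and each
  relation is a polynomial.
\<close>

lemma exists_annihilating_poly:
  fixes M :: "'a::euclidean_space \<Rightarrow> 'a"
  assumes "linear M"
  shows "\<exists>p. p \<noteq> 0 \<and> poly_op M p z = 0"
proof -
  define n where "n = DIM('a \<times> 'a)"
  define f where "f i = (map_prod M M ^^ i) z" for i
  show ?thesis
  proof (cases "inj_on f {..n}")
    case True
    have "card (f ` {..n}) = Suc n" using card_image[OF True] by simp
    then have "dependent (f ` {..n})"
      by (intro dependent_biggerset) (simp add: n_def)
    then obtain u v where uv: "v \<in> f ` {..n}" "u v \<noteq> 0" "(\<Sum>v\<in>f ` {..n}. u v *\<^sub>R v) = 0"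
      unfolding dependent_finite[OF finite_imageI[OF finite_atMost]] by blast
    then obtain j where j: "j \<le> n" "u (f j) \<noteq> 0" by auto
    define p where "p = (\<Sum>i\<le>n. monom (complex_of_real (u (f i))) i)"
    have "coeff p j = of_real (u (f j))"
      using j(1) by (simp add: p_def coeff_sum)
    then have "p \<noteq> 0" using j(2) by auto
    moreover have "poly_op M p z = (\<Sum>i\<le>n. u (f i) *\<^sub>R f i)"
      by (simp add: p_def poly_op_sum[OF assms] poly_op_monom[OF assms] cscale_of_real f_def)
    then have "poly_op M p z = 0"
      using uv(3) by (simp add: sum.reindex[OF True])
    ultimately show ?thesis by blast
  next
    case False
    then obtain i j where ij: "f i = f j" "i \<noteq> j" by (auto simp: inj_on_def)
    define p where "p = monom (1::complex) i + monom (- 1) j"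
    have "coeff p i = 1" using ij(2) by (simp add: p_def)
    then have "p \<noteq> 0" by auto
    moreover have "poly_op M p z = f i + cscale (- 1) (f j)"
      by (simp add: p_def poly_op_add[OF assms] poly_op_monom[OF assms] f_def)
    then have "poly_op M p z = 0"
      by (simp add: ij(1) cscale_def prod_eq_iff)
    ultimately show ?thesis by blast
  qed
qed

text \<open>
  Let \<open>p\<close> have least degree among the nonzero polynomials with \<open>p(M) z = 0\<close>, for some fixed
  \<open>z \<noteq> 0\<close>. Split off a root, \<open>p = (X - c) q\<close>. By minimality \<open>q(M) z \<noteq> 0\<close>, and
  \<open>M - c\<close> sends this vector to \<open>0\<close>.
\<close>

lemma exists_complex_eigenvalue:
  fixes M :: "'a::euclidean_space \<Rightarrow> 'a"
  assumes "linear M"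
  shows "\<exists>c. complex_eigenvalue M c"
proof -
  obtain b :: 'a where b: "b \<in> Basis" using nonempty_Basis by blast
  define z where "z = (b, 0::'a)"
  have z: "z \<noteq> 0" using b by (auto simp: z_def zero_prod_def)
  define P where "P p \<longleftrightarrow> p \<noteq> 0 \<and> poly_op M p z = 0" for p
  obtain p where p: "P p" and least: "\<And>q. P q \<Longrightarrow> degree p \<le> degree q"
    using exists_annihilating_poly[OF assms, of z] ex_has_least_nat[of P _ degree]
    unfolding P_def by blast
  have "degree p \<noteq> 0"
  proof
    assume "degree p = 0"
    then obtain a where "p = [:a:]" by (rule degree_eq_zeroE)
    then show False
      using p z by (auto simp: P_def cscale_eq_0_iff poly_op_pCons[OF assms]
          poly_op_0[OF assms] map_prod_0[OF assms])
  qed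
  then have "\<not> constant (poly p)" by (simp add: constant_degree)
  then obtain c where "poly p c = 0" using fundamental_theorem_of_algebra by blast
  then obtain q where q: "p = [:- c, 1:] * q" by (metis dvdE poly_eq_0_iff_dvd)
  have "q \<noteq> 0" using p q by (auto simp: P_def)
  then have "degree p = Suc (degree q)" using q by (simp add: degree_mult_eq del: mult_pCons_left)
  then have "\<not> P q" using least[of q] by auto
  then have w: "poly_op M q z \<noteq> 0" using \<open>q \<noteq> 0\<close> by (simp add: P_def)
  have "poly_op M [:- c, 1:] (poly_op M q z) = 0"
    using p q by (metis P_def poly_op_mult[OF assms])
  then have "map_prod M M (poly_op M q z) = cscale c (poly_op M q z)"
    by (simp add: poly_op_pCons[OF assms] poly_op_0[OF assms] map_prod_0[OF assms]
        cscale_def prod_eq_iff algebra_simps)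
  then show ?thesis using w unfolding complex_eigenvalue_def by blast
qed

text \<open>
  The product of annihilating polynomials of all basis vectors annihilates the whole space, and on
  an eigenvector for \<open>c\<close> it acts as multiplication by its value at \<open>c\<close>, which must vanish.
\<close>

lemma finite_complex_eigenvalues:
  fixes M :: "'a::euclidean_space \<Rightarrow> 'a"
  assumes "linear M"
  shows "finite {c. complex_eigenvalue M c}"
proof -
  obtain P where P: "\<And>z. P z \<noteq> 0 \<and> poly_op M (P z) z = 0"
    using exists_annihilating_poly[OF assms] by metis
  \<comment> \<open>\<open>Basis\<close> is the real basis of the product type, so \<open>b\<close> ranges over pairs.\<close>
  define p where "p = (\<Prod>b\<in>Basis. P b)"
  have "p \<noteq> 0" using P by (simp add: p_def)
  have "poly_op M p b = 0" if b: "b \<in> Basis" for b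
  proof -
    have "p = (\<Prod>b\<in>Basis - {b}. P b) * P b"
      using b by (simp add: p_def prod.remove mult.commute)
    then show ?thesis
      using P linear_0[OF linear_poly_op[OF assms]] by (simp add: poly_op_mult[OF assms])
  qed
  then have ann: "poly_op M p z = 0" for z
    using linear_eq_stdbasis[OF linear_poly_op[OF assms] linear_zero]
    by (metis (no_types, lifting))
  have "poly p c = 0" if "complex_eigenvalue M c" for c
    using that ann poly_op_eigenvector[OF assms]
    by (metis complex_eigenvalue_def cscale_eq_0_iff)
  then have "{c. complex_eigenvalue M c} \<subseteq> {c. poly p c = 0}" by auto
  then show ?thesis using poly_roots_finite[OF \<open>p \<noteq> 0\<close>] finite_subset by blast
qed

lemma finite_eigenvalue_moduli:
  fixes M :: "'a::euclidean_space \<Rightarrow> 'a"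
  assumes "linear M"
  shows "finite {cmod c | c. complex_eigenvalue M c}"
  using finite_imageI[OF finite_complex_eigenvalues[OF assms], of cmod]
  by (simp add: setcompr_eq_image)

lemma spectral_radius_le:
  fixes M :: "'a::euclidean_space \<Rightarrow> 'a"
  assumes "linear M" "\<And>c. complex_eigenvalue M c \<Longrightarrow> cmod c \<le> r"
  shows "spectral_radius M \<le> r"
  unfolding spectral_radius_def
  using finite_eigenvalue_moduli[OF assms(1)] exists_complex_eigenvalue[OF assms(1)] assms(2)
  by (subst Max_le_iff) auto

lemma cmod_le_spectral_radius:
  fixes M :: "'a::euclidean_space \<Rightarrow> 'a"
  assumes "linear M" "complex_eigenvalue M c"
  shows "cmod c \<le> spectral_radius M"
  unfolding spectral_radius_def
  using finite_eigenvalue_moduli[OF assms(1)] assms(2) by (intro Max_ge) auto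

lemma complex_eigenvalue_of_real:
  assumes "linear M" "u \<noteq> 0" "M u = r *\<^sub>R u"
  shows "complex_eigenvalue M (of_real r)"
  unfolding complex_eigenvalue_def
  using assms by (intro exI[of _ "(u, 0)"]) (simp add: cscale_of_real linear_0 zero_prod_def)

section \<open>The inner product of a positive definite operator\<close>

locale positive_definite =
  fixes A :: "'a::euclidean_space \<Rightarrow> 'a"
  assumes linear_A: "linear A"
    and self_adjoint: "adjoint A = A"
    and positive: "u \<noteq> 0 \<Longrightarrow> A u \<bullet> u > 0"
begin

lemma inner_wrt_commute: "inner_wrt A u v = inner_wrt A v u"
  using adjoint_works[OF linear_A, of u v] by (simp add: inner_wrt_def self_adjoint inner_commute)

lemma inner_wrt_linear:
  "inner_wrt A (u + v) w = inner_wrt A u w + inner_wrt A v w"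
  "inner_wrt A (u - v) w = inner_wrt A u w - inner_wrt A v w"
  "inner_wrt A (r *\<^sub>R u) w = r * inner_wrt A u w"
  "inner_wrt A w (u + v) = inner_wrt A w u + inner_wrt A w v"
  "inner_wrt A w (u - v) = inner_wrt A w u - inner_wrt A w v"
  "inner_wrt A w (r *\<^sub>R u) = r * inner_wrt A w u"
  using linear_A
  by (simp_all add: inner_wrt_def linear_add linear_diff linear_scale inner_simps)

lemma inner_wrt_ge_0: "inner_wrt A u u \<ge> 0"
  using positive[of u] by (cases "u = 0") (auto simp: inner_wrt_def)

lemma inner_wrt_eq_0_iff: "inner_wrt A u u = 0 \<longleftrightarrow> u = 0"
  using positive[of u] by (cases "u = 0") (auto simp: inner_wrt_def)

lemma norm_wrt_power2: "(norm_wrt A u)\<^sup>2 = inner_wrt A u u"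
  by (simp add: norm_wrt_def inner_wrt_ge_0)

lemma norm_wrt_ge_0: "norm_wrt A u \<ge> 0"
  by (simp add: norm_wrt_def inner_wrt_ge_0)

lemma norm_wrt_eq_0_iff: "norm_wrt A u = 0 \<longleftrightarrow> u = 0"
  by (simp add: norm_wrt_def inner_wrt_eq_0_iff)

lemma norm_wrt_0 [simp]: "norm_wrt A 0 = 0"
  by (simp add: norm_wrt_eq_0_iff)

lemma norm_wrt_gt_0: "u \<noteq> 0 \<Longrightarrow> norm_wrt A u > 0"
  using norm_wrt_ge_0[of u] norm_wrt_eq_0_iff[of u] by linarith

lemma norm_wrt_scaleR: "norm_wrt A (r *\<^sub>R u) = \<bar>r\<bar> * norm_wrt A u"
  by (simp add: norm_wrt_def inner_wrt_linear real_sqrt_mult flip: mult.assoc)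

lemma continuous_on_norm_wrt:
  fixes M :: "'a \<Rightarrow> 'a"
  assumes "linear M"
  shows "continuous_on S (\<lambda>u. norm_wrt A (M u))"
proof -
  have "continuous_on S M" by (rule linear_continuous_on_compose[OF continuous_on_id assms])
  then show ?thesis
    unfolding norm_wrt_def inner_wrt_def
    by (intro continuous_intros linear_continuous_on_compose[OF _ linear_A])
qed

text \<open>
  Cauchy-Schwarz. The vector \<open>w\<close> is \<open>(v, v)\<^sub>A\<close> times the component of \<open>u\<close> that is
  \<open>A\<close>-orthogonal to \<open>v\<close>.
\<close>

lemma inner_wrt_le_norms: "inner_wrt A u v \<le> norm_wrt A u * norm_wrt A v"
proof (cases "v = 0")
  case True
  then show ?thesis using inner_wrt_linear(6)[of u 0 0] by simp
next
  case False
  then have pos: "inner_wrt A v v > 0"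
    using inner_wrt_ge_0[of v] inner_wrt_eq_0_iff[of v] by linarith
  define w where "w = inner_wrt A v v *\<^sub>R u - inner_wrt A u v *\<^sub>R v"
  have "0 \<le> inner_wrt A w w" by (rule inner_wrt_ge_0)
  also have "\<dots> = inner_wrt A v v * (inner_wrt A u u * inner_wrt A v v - (inner_wrt A u v)\<^sup>2)"
    by (simp add: w_def inner_wrt_linear inner_wrt_commute[of v u] algebra_simps power2_eq_square)
  finally have "(inner_wrt A u v)\<^sup>2 \<le> inner_wrt A u u * inner_wrt A v v"
    using pos by (simp add: zero_le_mult_iff)
  then show ?thesis
    by (metis abs_le_D1 norm_wrt_def real_sqrt_abs real_sqrt_le_iff real_sqrt_mult)
qed

subsection \<open>Operator norms\<close>

text \<open>
  The quotient of the norms is invariant under scaling, so its supremum is that of a continuous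
  function on the compact Euclidean unit sphere. Attainment shows at once that the supremum is
  finite and that it is the best constant in \<open>\<parallel>M v\<parallel>\<^sub>A \<le> r \<parallel>v\<parallel>\<^sub>A\<close>.
\<close>

lemma onorm_wrt_attained:
  assumes "linear M"
  obtains u where "u \<noteq> 0" "norm_wrt A (M u) = onorm_wrt A M * norm_wrt A u"
    "\<And>v. norm_wrt A (M v) \<le> onorm_wrt A M * norm_wrt A v"
proof -
  define q where "q u = norm_wrt A (M u) / norm_wrt A u" for u
  have "continuous_on (sphere 0 1) q"
    unfolding q_def using continuous_on_norm_wrt[OF assms] continuous_on_norm_wrt[OF linear_id]
    by (intro continuous_on_divide) (auto simp: norm_wrt_eq_0_iff)
  moreover have "sphere 0 1 \<noteq> ({} :: 'a set)" by simp
  ultimately obtain u where u: "norm u = 1" "\<And>v. norm v = 1 \<Longrightarrow> q v \<le> q u"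
    using continuous_attains_sup[of "sphere (0::'a) 1" q] by auto
  have max: "q v \<le> q u" if "v \<noteq> 0" for v
  proof -
    have "q v = q (inverse (norm v) *\<^sub>R v)"
      using that by (simp add: q_def norm_wrt_scaleR linear_scale[OF assms])
    also have "\<dots> \<le> q u" using that by (intro u(2)) simp
    finally show ?thesis .
  qed
  have "u \<noteq> 0" using u(1) by auto
  have "onorm_wrt A M = q u"
    unfolding onorm_wrt_def q_def[symmetric]
    using \<open>u \<noteq> 0\<close> max by (intro cSup_eq_maximum) auto
  show ?thesis
  proof
    show "u \<noteq> 0" by fact
    show "norm_wrt A (M u) = onorm_wrt A M * norm_wrt A u"
      using \<open>u \<noteq> 0\<close> by (simp add: \<open>onorm_wrt A M = q u\<close> q_def norm_wrt_eq_0_iff)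
    show "norm_wrt A (M v) \<le> onorm_wrt A M * norm_wrt A v" for v
    proof (cases "v = 0")
      case True
      then show ?thesis using linear_0[OF assms] by simp
    next
      case False
      then show ?thesis using max[of v] norm_wrt_gt_0[of v]
        by (simp add: \<open>onorm_wrt A M = q u\<close> q_def[of v] pos_divide_le_eq)
    qed
  qed
qed

lemma norm_wrt_le_onorm_wrt:
  assumes "linear M"
  shows "norm_wrt A (M v) \<le> onorm_wrt A M * norm_wrt A v"
  using onorm_wrt_attained[OF assms] by blast

lemma onorm_wrt_leI:
  assumes "linear M" "\<And>u. norm_wrt A (M u) \<le> r * norm_wrt A u"
  shows "onorm_wrt A M \<le> r"
proof -
  obtain u where "u \<noteq> 0" "norm_wrt A (M u) = onorm_wrt A M * norm_wrt A u"
    using onorm_wrt_attained[OF assms(1)] by blast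
  then show ?thesis using assms(2)[of u] norm_wrt_gt_0[of u] by simp
qed

lemma onorm_wrt_ge_0:
  assumes "linear M"
  shows "onorm_wrt A M \<ge> 0"
proof -
  obtain u where "u \<noteq> 0" "norm_wrt A (M u) = onorm_wrt A M * norm_wrt A u"
    using onorm_wrt_attained[OF assms] by blast
  then show ?thesis using norm_wrt_ge_0[of "M u"] norm_wrt_gt_0[of u]
    by (simp add: zero_le_mult_iff)
qed

lemma onorm_wrt_comp_le:
  assumes "linear M" "linear N"
  shows "onorm_wrt A (M \<circ> N) \<le> onorm_wrt A M * onorm_wrt A N"
proof (rule onorm_wrt_leI)
  show "linear (M \<circ> N)" using assms by (intro linear_compose)
  fix u
  have "norm_wrt A (M (N u)) \<le> onorm_wrt A M * norm_wrt A (N u)"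
    by (rule norm_wrt_le_onorm_wrt[OF assms(1)])
  also have "\<dots> \<le> onorm_wrt A M * (onorm_wrt A N * norm_wrt A u)"
    using assms by (intro mult_left_mono norm_wrt_le_onorm_wrt onorm_wrt_ge_0)
  finally show "norm_wrt A ((M \<circ> N) u) \<le> onorm_wrt A M * onorm_wrt A N * norm_wrt A u"
    by (simp add: mult.assoc)
qed

text \<open>
  For an eigenvector \<open>x + i y\<close> the cross terms \<open>(x, y)\<^sub>A\<close> cancel in
  \<open>\<parallel>M x\<parallel>\<^sup>2 + \<parallel>M y\<parallel>\<^sup>2\<close>, which leaves \<open>(cmod c)\<^sup>2 (\<parallel>x\<parallel>\<^sup>2 + \<parallel>y\<parallel>\<^sup>2)\<close>. The norm
  bound for \<open>M\<close> then applies to \<open>x\<close> and \<open>y\<close> separately.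
\<close>

lemma spectral_radius_le_onorm_wrt:
  assumes "linear M"
  shows "spectral_radius M \<le> onorm_wrt A M"
proof (rule spectral_radius_le[OF assms])
  fix c assume "complex_eigenvalue M c"
  then obtain x y where nz: "(x, y) \<noteq> 0" and Mx: "M x = Re c *\<^sub>R x - Im c *\<^sub>R y"
    and My: "M y = Re c *\<^sub>R y + Im c *\<^sub>R x"
    by (auto simp: complex_eigenvalue_def cscale_def)
  define s where "s = inner_wrt A x x + inner_wrt A y y"
  have "s > 0"
    using nz inner_wrt_ge_0[of x] inner_wrt_ge_0[of y] inner_wrt_eq_0_iff[of x]
      inner_wrt_eq_0_iff[of y] by (auto simp: s_def zero_prod_def)
  have "(cmod c)\<^sup>2 * s = inner_wrt A (M x) (M x) + inner_wrt A (M y) (M y)"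
    unfolding cmod_power2
    by (simp add: Mx My s_def inner_wrt_linear inner_wrt_commute[of y x]
        algebra_simps power2_eq_square)
  also have "\<dots> \<le> (onorm_wrt A M)\<^sup>2 * s"
  proof -
    have "inner_wrt A (M v) (M v) \<le> (onorm_wrt A M)\<^sup>2 * inner_wrt A v v" for v
      using power_mono[OF norm_wrt_le_onorm_wrt[OF assms] norm_wrt_ge_0, of v 2]
      by (simp add: power_mult_distrib norm_wrt_power2)
    from this[of x] this[of y] show ?thesis by (simp add: s_def algebra_simps)
  qed
  finally have "(cmod c)\<^sup>2 \<le> (onorm_wrt A M)\<^sup>2" using \<open>s > 0\<close> by simp
  then show "cmod c \<le> onorm_wrt A M"
    using onorm_wrt_ge_0[OF assms] by (rule power2_le_imp_le)
qed

subsection \<open>The adjoint\<close>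

lemma adjoint_wrt_unique:
  assumes "linear F" "\<And>u v. inner_wrt A (E u) v = inner_wrt A u (F v)"
  shows "adjoint_wrt A E = F"
  unfolding adjoint_wrt_def
proof (rule the_equality)
  show "linear F \<and> (\<forall>u v. inner_wrt A (E u) v = inner_wrt A u (F v))"
    using assms by blast
next
  fix G assume "linear G \<and> (\<forall>u v. inner_wrt A (E u) v = inner_wrt A u (G v))"
  then have "inner_wrt A (G v - F v) (G v - F v) = 0" for v
    using assms(2) by (metis inner_wrt_linear(5) diff_self)
  then show "G = F" by (auto simp: inner_wrt_eq_0_iff)
qed

text \<open>
  In terms of the Euclidean adjoint, the \<open>A\<close>-adjoint is the inverse of \<open>A\<close> composed with the
  adjoint of \<open>E\<close> and with \<open>A\<close>; definiteness makes \<open>A\<close> injective, hence invertible.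
\<close>

lemma adjoint_wrt_works:
  assumes "linear E"
  shows linear_adjoint_wrt: "linear (adjoint_wrt A E)"
    and "inner_wrt A (E u) v = inner_wrt A u (adjoint_wrt A E v)"
proof -
  have "inj A"
    using linear_A positive by (metis inner_zero_left less_irrefl linear_injective_0)
  then obtain B where B: "linear B" "\<And>x. A (B x) = x"
    using linear_injective_isomorphism[OF linear_A] by blast
  define F where "F = B \<circ> adjoint E \<circ> A"
  have F: "linear F"
    unfolding F_def by (intro linear_compose linear_A B(1) adjoint_linear assms)
  have *: "inner_wrt A (E u) v = inner_wrt A u (F v)" for u v
  proof -
    have "inner_wrt A (E u) v = A v \<bullet> E u" 
      using inner_wrt_commute[of "E u" v] by (simp add: inner_wrt_def)
    also have "\<dots> = A (F v) \<bullet> u"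
      by (simp add: F_def B(2) adjoint_works[OF assms, of u] inner_commute)
    also have "\<dots> = inner_wrt A u (F v)"
      using inner_wrt_commute[of u "F v"] by (simp add: inner_wrt_def)
    finally show ?thesis .
  qed
  have "adjoint_wrt A E = F" using F * by (rule adjoint_wrt_unique)
  then show "linear (adjoint_wrt A E)"
    and "inner_wrt A (E u) v = inner_wrt A u (adjoint_wrt A E v)"
    using F * by simp_all
qed

text \<open>
  By Cauchy-Schwarz \<open>\<parallel>F v\<parallel>\<^sup>2 = (E F v, v)\<^sub>A \<le> \<parallel>E\<parallel> \<parallel>F v\<parallel> \<parallel>v\<parallel>\<close>. The adjoint relation is
  symmetric in \<open>E\<close> and \<open>F\<close>, so this one inequality also gives the converse.
\<close>

lemma onorm_wrt_le_of_adjoint: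
  assumes "linear E" "linear F" "\<And>u v. inner_wrt A (E u) v = inner_wrt A u (F v)"
  shows "onorm_wrt A F \<le> onorm_wrt A E"
proof (rule onorm_wrt_leI[OF assms(2)])
  fix v
  have "norm_wrt A (F v) * norm_wrt A (F v) = inner_wrt A (E (F v)) v"
    by (simp add: assms(3) flip: norm_wrt_power2 power2_eq_square)
  also have "\<dots> \<le> norm_wrt A (E (F v)) * norm_wrt A v" by (rule inner_wrt_le_norms)
  also have "\<dots> \<le> onorm_wrt A E * norm_wrt A (F v) * norm_wrt A v"
    by (intro mult_right_mono norm_wrt_le_onorm_wrt assms norm_wrt_ge_0)
  finally have "norm_wrt A (F v) * norm_wrt A (F v)
      \<le> (onorm_wrt A E * norm_wrt A v) * norm_wrt A (F v)"
    by (simp add: ac_simps)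
  then show "norm_wrt A (F v) \<le> onorm_wrt A E * norm_wrt A v"
    using norm_wrt_ge_0[of "F v"] norm_wrt_ge_0[of v] onorm_wrt_ge_0[OF assms(1)]
    by (cases "norm_wrt A (F v) = 0") auto
qed

lemma onorm_wrt_adjoint_wrt:
  assumes "linear E"
  shows "onorm_wrt A (adjoint_wrt A E) = onorm_wrt A E"
proof (rule antisym)
  note works = adjoint_wrt_works[OF assms]
  show "onorm_wrt A (adjoint_wrt A E) \<le> onorm_wrt A E"
    using assms works by (rule onorm_wrt_le_of_adjoint)
  show "onorm_wrt A E \<le> onorm_wrt A (adjoint_wrt A E)"
    using works(1) assms
    by (rule onorm_wrt_le_of_adjoint) (metis works(2) inner_wrt_commute)
qed

text \<open>
  A vector \<open>u\<close> at which the adjoint attains its norm \<open>K\<close> is an eigenvector of \<open>E F\<close> for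
  \<open>K\<^sup>2\<close>, because the squared norm of \<open>E F u - K\<^sup>2 u\<close> is both nonnegative and at most
  \<open>K\<^sup>4 \<parallel>u\<parallel>\<^sup>2 - 2 K\<^sup>4 \<parallel>u\<parallel>\<^sup>2 + K\<^sup>4 \<parallel>u\<parallel>\<^sup>2 = 0\<close>.
\<close>

lemma onorm_wrt_power2_le_spectral_radius:
  assumes "linear E"
  shows "(onorm_wrt A E)\<^sup>2 \<le> spectral_radius (E \<circ> adjoint_wrt A E)"
proof -
  define F where "F = adjoint_wrt A E"
  define K where "K = onorm_wrt A E"
  have F: "linear F" "\<And>u v. inner_wrt A (E u) v = inner_wrt A u (F v)"
    using adjoint_wrt_works[OF assms] by (simp_all add: F_def)
  have "onorm_wrt A F = K"
    using onorm_wrt_adjoint_wrt[OF assms] by (simp add: F_def K_def)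
  then obtain u where u: "u \<noteq> 0" "norm_wrt A (F u) = K * norm_wrt A u"
    using onorm_wrt_attained[OF F(1)] by metis
  define s where "s = inner_wrt A u u"
  have FF: "inner_wrt A (F u) (F u) = K\<^sup>2 * s"
    using u(2) by (metis norm_wrt_power2 power_mult_distrib s_def)
  have "norm_wrt A (E (F u)) \<le> K * (K * norm_wrt A u)"
    using norm_wrt_le_onorm_wrt[OF assms, of "F u"] by (simp add: K_def[symmetric] u(2))
  then have "(norm_wrt A (E (F u)))\<^sup>2 \<le> (K * (K * norm_wrt A u))\<^sup>2"
    by (intro power_mono norm_wrt_ge_0)
  then have EF: "inner_wrt A (E (F u)) (E (F u)) \<le> K ^ 4 * s"
    by (simp add: norm_wrt_power2 s_def power_mult_distrib)
  define w where "w = E (F u) - K\<^sup>2 *\<^sub>R u"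
  have "inner_wrt A w w
      = inner_wrt A (E (F u)) (E (F u)) - 2 * K\<^sup>2 * inner_wrt A (F u) (F u) + K ^ 4 * s"
    using F(2)[of "F u" u] inner_wrt_commute[of u "E (F u)"]
    by (simp add: w_def inner_wrt_linear s_def algebra_simps power2_eq_square power4_eq_xxxx)
  also have "\<dots> \<le> 0" using EF by (simp add: FF power2_eq_square power4_eq_xxxx)
  finally have "w = 0" using inner_wrt_ge_0[of w] inner_wrt_eq_0_iff[of w] by simp
  then have "(E \<circ> F) u = K\<^sup>2 *\<^sub>R u" by (simp add: w_def)
  moreover have lin: "linear (E \<circ> F)" using F(1) assms by (rule linear_compose)
  ultimately have "complex_eigenvalue (E \<circ> F) (of_real (K\<^sup>2))"
    using u(1) complex_eigenvalue_of_real by blast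
  from cmod_le_spectral_radius[OF lin this] show ?thesis
    by (simp add: F_def K_def norm_power)
qed

end

section \<open>The chain of inequalities\<close>

theorem lemma5p1:
  fixes A E :: "'a::euclidean_space \<Rightarrow> 'a"
  assumes "linear A"
    and "adjoint A = A"
    and "\<And>u. u \<noteq> 0 \<Longrightarrow> A u \<bullet> u > 0"
    and "linear E"
  shows "spectral_radius (E \<circ> E) \<le> onorm_wrt A (E \<circ> E)
    \<and> onorm_wrt A (E \<circ> E) \<le> (onorm_wrt A E)\<^sup>2
    \<and> (onorm_wrt A E)\<^sup>2 = onorm_wrt A (E \<circ> adjoint_wrt A E)
    \<and> onorm_wrt A (E \<circ> adjoint_wrt A E) = spectral_radius (E \<circ> adjoint_wrt A E)"
proof -
  interpret positive_definite A using assms(1-3) by (rule positive_definite.intro)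
  have lin: "linear (adjoint_wrt A E)" using assms(4) by (rule linear_adjoint_wrt)
  have "spectral_radius (E \<circ> E) \<le> onorm_wrt A (E \<circ> E)"
    using assms(4) by (intro spectral_radius_le_onorm_wrt linear_compose)
  moreover have "onorm_wrt A (E \<circ> E) \<le> (onorm_wrt A E)\<^sup>2"
    using onorm_wrt_comp_le[OF assms(4) assms(4)] by (simp add: power2_eq_square)
  moreover have "onorm_wrt A (E \<circ> adjoint_wrt A E) \<le> (onorm_wrt A E)\<^sup>2"
    using onorm_wrt_comp_le[OF assms(4) lin]
    by (simp add: power2_eq_square onorm_wrt_adjoint_wrt[OF assms(4)])
  moreover have "spectral_radius (E \<circ> adjoint_wrt A E) \<le> onorm_wrt A (E \<circ> adjoint_wrt A E)"
    using lin assms(4) by (intro spectral_radius_le_onorm_wrt linear_compose)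
  moreover note onorm_wrt_power2_le_spectral_radius[OF assms(4)]
  ultimately show ?thesis by linarith
qed

end
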